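(* For any $A\in\mathbb{C}^{n\times n}$ there exists a self-adjoint matrix $S\in\mathbb{C}^{n\times n}$ (that is, $S=S^*$) such that $d_r(A,S)\le d_r(A,A^* )$.
   Context: $A^*$ denotes the adjoint (conjugate transpose) of $A$. For $A,B\in\mathbb{C}^{n\times n}$, $d_r(A,B)=\frac{\operatorname{rank}(A-B)}{n}$ is the normalized arithmetic distance. *)

theory Defs
  imports
    Complex_Main
    "Jordan_Normal_Form.DL_Rank"
    "Jordan_Normal_Form.Schur_Decomposition"
begin

definition self_adjoint_mat :: "complex mat \<Rightarrow> bool"
  where "self_adjoint_mat S \<longleftrightarrow> S = mat_adjoint S"

(* vec_space.rank n is the column rank in dimension n; both arguments are meant to be n x n.
   For n = 0 the value is 0 / 0 = 0. *)
definition norm_arith_dist :: "nat \<Rightarrow> complex mat \<Rightarrow> complex mat \<Rightarrow> real"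
  where "norm_arith_dist n A B = real (vec_space.rank n (A - B)) / real n"

end

theory Submission
  imports Defs
begin

text \<open>The witness is the Hermitian part \<open>(A + A\<^sup>*) / 2\<close>: its difference from \<open>A\<close>
  is \<open>(A - A\<^sup>*) / 2\<close>, a nonzero scalar multiple of \<open>A - A\<^sup>*\<close>, so the two distances even agree.\<close>

text \<open>The column space is the range of \<open>x \<mapsto> A *\<^sub>v x\<close>. The scalar
  can be moved onto \<open>x\<close>, and scaling by a nonzero \<open>c\<close> permutes
  \<open>carrier_vec nc\<close>, so the range is unchanged.\<close>

lemma (in vec_space) col_space_smult:
  assumes A: "A \<in> carrier_mat n nc" and c: "c \<noteq> 0"
  shows "col_space (c \<cdot>\<^sub>m A) = col_space A"
proof -
  have cA: "c \<cdot>\<^sub>m A \<in> carrier_mat n nc" using A by simp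
  have mv: "(c \<cdot>\<^sub>m A) *\<^sub>v x = A *\<^sub>v (c \<cdot>\<^sub>v x)" if "x \<in> carrier_vec nc" for x
    using A that by (intro eq_vecI) auto
  have "(\<exists>x\<in>carrier_vec nc. (c \<cdot>\<^sub>m A) *\<^sub>v x = y) \<longleftrightarrow> (\<exists>x\<in>carrier_vec nc. A *\<^sub>v x = y)" for y
  proof
    assume "\<exists>x\<in>carrier_vec nc. (c \<cdot>\<^sub>m A) *\<^sub>v x = y"
    then show "\<exists>x\<in>carrier_vec nc. A *\<^sub>v x = y"
      using mv smult_carrier_vec by metis
  next
    assume "\<exists>x\<in>carrier_vec nc. A *\<^sub>v x = y"
    then obtain x where x: "x \<in> carrier_vec nc" "A *\<^sub>v x = y" by blast
    \<comment> \<open>Here \<open>c \<noteq> 0\<close> enters: a preimage under \<open>A\<close> is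
      rescaled by \<open>inverse c\<close>.\<close>
    have "(c \<cdot>\<^sub>m A) *\<^sub>v (inverse c \<cdot>\<^sub>v x) = y"
      using x c by (simp add: mv smult_smult_assoc)
    then show "\<exists>x\<in>carrier_vec nc. (c \<cdot>\<^sub>m A) *\<^sub>v x = y"
      using x by (metis smult_carrier_vec)
  qed
  then show ?thesis
    using A by (simp add: col_space_eq[OF A] col_space_eq[OF cA])
qed

lemma (in vec_space) rank_smult:
  assumes "A \<in> carrier_mat n nc" and "c \<noteq> 0"
  shows "rank (c \<cdot>\<^sub>m A) = rank A"
  \<comment> \<open>\<open>rank\<close> depends on a matrix only through the span of its
    columns.\<close>
  using col_space_smult[OF assms] by (simp add: rank_def col_space_def)

lemma mat_adjoint_carrier:
  "A \<in> carrier_mat n n \<Longrightarrow> mat_adjoint A \<in> carrier_mat n n"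
  by (auto simp: mat_adjoint_def)

text \<open>\<open>mat_adjoint\<close> is built from conjugated columns taken as rows; the entrywise
  form lets self-adjointness be checked by \<open>eq_matI\<close>.\<close>

lemma mat_adjoint_index:
  assumes "A \<in> carrier_mat n n" "i < n" "j < n"
  shows "mat_adjoint A $$ (i, j) = conjugate (A $$ (j, i))"
  using assms by (simp add: mat_adjoint_def mat_of_rows_index)

theorem theorem6:
  fixes n :: nat and A :: "complex mat"
  assumes "A \<in> carrier_mat n n"
  shows "\<exists>S \<in> carrier_mat n n. self_adjoint_mat S \<and>
           norm_arith_dist n A S \<le> norm_arith_dist n A (mat_adjoint A)"
proof
  let ?S = "(1/2) \<cdot>\<^sub>m (A + mat_adjoint A)"
  have adj: "mat_adjoint A \<in> carrier_mat n n"
    using assms mat_adjoint_carrier by blast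
  show S: "?S \<in> carrier_mat n n" using adj assms by simp
  have "self_adjoint_mat ?S"
    unfolding self_adjoint_mat_def
  proof (rule eq_matI)
    fix i j
    assume "i < dim_row (mat_adjoint ?S)" "j < dim_col (mat_adjoint ?S)"
    then have "i < n" "j < n" using mat_adjoint_carrier[OF S] by auto
    then show "?S $$ (i, j) = mat_adjoint ?S $$ (i, j)"
      \<comment> \<open>Conjugating and transposing swaps the summands \<open>A\<close> and
        \<open>mat_adjoint A\<close> and fixes the real factor \<open>1/2\<close>.\<close>
      using assms adj by (simp add: mat_adjoint_index[OF S] mat_adjoint_index[OF assms])
  qed (use S mat_adjoint_carrier[OF S] in auto)
  moreover have "A - ?S = (1/2) \<cdot>\<^sub>m (A - mat_adjoint A)"
    using assms adj by (intro eq_matI) (auto simp: field_simps)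
  \<comment> \<open>Both distances divide equal ranks by the same \<open>n\<close>, so
    \<open>n = 0\<close> needs no separate case.\<close>
  then have "norm_arith_dist n A ?S = norm_arith_dist n A (mat_adjoint A)"
    using vec_space.rank_smult[of "A - mat_adjoint A" n n "1/2"] minus_carrier_mat[OF adj]
    by (simp add: norm_arith_dist_def)
  ultimately show "self_adjoint_mat ?S \<and>
      norm_arith_dist n A ?S \<le> norm_arith_dist n A (mat_adjoint A)"
    by simp
qed

end
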